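(* For $n\ge 0$ let $K(n)=\sum_{i,j=0}^{n}\binom{i+j}{i}\binom{i+j}{j}$. Then the limit $\lim_{n\to\infty}K(n)/\binom{2n}{n}^2$ exists and $$\lim_{n\to\infty}\frac{K(n)}{\binom{2n}{n}^{2}}=\sup_{n\ge 0}\frac{K(n)}{\binom{2n}{n}^{2}}=\frac{16}{9},$$ which implies that, as $n\to\infty$, $$K(n)=\Big(\frac{16}{9}+o(1)\Big)\binom{2n}{n}^2=\frac{16^{n+1}}{9\pi n}\big(1+o(1)\big).$$ *)

theory Defs
  imports Complex_Main "HOL-Library.Landau_Symbols"
begin

definition K :: "nat \<Rightarrow> nat" where
  "K n = (\<Sum>i=0..n. \<Sum>j=0..n. ((i + j) choose i) * ((i + j) choose j))"

end

theory Submission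
  imports Defs "HOL-Real_Asymp.Real_Asymp" "HOL-Analysis.Gamma_Function"
begin

text \<open>
  Since \<open>(i + j) choose i = (i + j) choose j\<close>, the number \<open>K n\<close> is the sum of the squares of the
  entries of Pascal's triangle over the square \<open>i, j \<le> n\<close>. The corner \<open>i = j = n\<close> dominates: for
  fixed \<open>a\<close> and \<open>b\<close> the entry at \<open>(n - a, n - b)\<close> is asymptotically \<open>2\<close> to the power \<open>- (a + b)\<close>
  times the central one, so \<open>K n / ((2 * n) choose n) ^ 2\<close> ought to tend to the product of two
  geometric series of ratio \<open>1 / 4\<close>, that is \<open>(4 / 3) ^ 2 = 16 / 9\<close>.

  Any finite block of these terms is contained in \<open>K n\<close>, which bounds the lower limit by
  \<open>16 / 9\<close> from below (\<open>shifted_central_binomial_ratio_tendsto\<close>, \<open>K_ratio_ge_partial_sum\<close>).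
  Instead of dominating the tail, the proof shows that \<open>16 / 9\<close> bounds every single ratio (\<open>K_le\<close>);
  this closes the squeeze and also identifies the supremum. The upper bound is an induction on \<open>n\<close>.
  The growth \<open>K (n + 1) - K n\<close> consists of two equal border rows and the new corner, and a border
  row \<open>N\<close> has growing terms whose consecutive ratios shrink, so each of its partial sums is at most
  what a geometric series with the last ratio would give (\<open>sum_binomial_squares_le\<close>).

  The form with \<open>pi\<close> follows from the asymptotics of the central binomial coefficient, which is
  Wallis' product in disguise.
\<close>

section \<open>Squares of binomial coefficients\<close>

lemma K_eq_sum_squares: "real (K n) = (\<Sum>i\<le>n. \<Sum>j\<le>n. real ((i + j) choose i) ^ 2)"
proof -
  have "((i + j) choose i) * ((i + j) choose j) = ((i + j) choose i) ^ 2" for i j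
    using binomial_symmetric[of i "i + j"] by (simp add: power2_eq_square)
  then show ?thesis
    unfolding K_def by (simp add: atLeast0AtMost)
qed

lemma Suc_times_shifted_binomial:
  "real (Suc k) * real ((N + Suc k) choose Suc k) = real (N + Suc k) * real ((N + k) choose k)"
proof -
  have "Suc k * ((N + Suc k) choose Suc k) = (N + Suc k) * ((N + k) choose k)"
    using Suc_times_binomial_eq[of "N + k" k] by (simp add: mult.commute)
  then show ?thesis
    by (metis of_nat_mult)
qed

text \<open>
  The entry \<open>(2 * n + 1) choose n\<close> lies between two consecutive central coefficients and is a border
  term of the new row of \<open>K (Suc n)\<close>; expressing both central coefficients by it makes the
  induction step for \<open>K\<close> homogeneous in one quantity.
\<close>
lemma central_binomial_via_odd_row:
  "real ((2 * n) choose n) = (real n + 1) / (2 * real n + 1) * real ((Suc n + n) choose n)"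
  "real ((2 * Suc n) choose Suc n) = 2 * real ((Suc n + n) choose n)"
proof -
  have sym: "(Suc n + n) choose Suc n = (Suc n + n) choose n"
    using binomial_symmetric[of n "Suc n + n"] by simp
  have coeffs: "real (Suc n) = real n + 1" "real (Suc n + n) = 2 * real n + 1" by simp_all
  have "(real n + 1) * real ((Suc n + n) choose n) = (2 * real n + 1) * real ((2 * n) choose n)"
    using Suc_times_shifted_binomial[of n n]
    unfolding add.commute[of n "Suc n"] sym coeffs mult_2[symmetric] .
  moreover have "2 * real n + 1 \<noteq> 0" by simp
  ultimately show "real ((2 * n) choose n) = (real n + 1) / (2 * real n + 1) * real ((Suc n + n) choose n)"
    by (simp only: times_divide_eq_left) simp
  have "(2 * Suc n) choose Suc n = (Suc (Suc n + n)) choose Suc n"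
    by (simp only: mult_2 add_Suc_right)
  also have "\<dots> = ((Suc n + n) choose n) + ((Suc n + n) choose Suc n)"
    by (rule binomial_Suc_Suc)
  also have "\<dots> = 2 * ((Suc n + n) choose n)"
    by (simp only: sym mult_2)
  finally show "real ((2 * Suc n) choose Suc n) = 2 * real ((Suc n + n) choose n)"
    by (simp only: of_nat_mult of_nat_numeral)
qed

section \<open>The upper bound\<close>

text \<open>
  The term ratio \<open>(k / (N + k)) ^ 2\<close> from index \<open>k\<close> down to \<open>k - 1\<close> increases with \<open>k\<close>, so going
  down from the last term the terms decrease at least as fast as the geometric series with the ratio
  at \<open>k\<close>. The factor on the right is the sum of that series:
  \<open>1 / (1 - (k / (N + k)) ^ 2) = (N + k) ^ 2 / (N * (N + 2 * k))\<close>.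
\<close>
lemma sum_binomial_squares_le:
  assumes "N \<ge> 1"
  shows "(\<Sum>j\<le>k. real ((N + j) choose j) ^ 2)
    \<le> real (N + k) ^ 2 / (real N * real (N + 2 * k)) * real ((N + k) choose k) ^ 2"
proof (induction k)
  case 0
  then show ?case using assms by (simp add: power2_eq_square)
next
  case (Suc k)
  define x where "x = real N"
  define y where "y = real k"
  define t where "t = real ((N + k) choose k) ^ 2"
  define t' where "t' = real ((N + Suc k) choose Suc k) ^ 2"
  have x: "x \<ge> 1" and y: "y \<ge> 0" using assms by (auto simp: x_def y_def)
  have "t' \<ge> 0" by (simp add: t'_def)
  have "(y + 1) ^ 2 * t' = (x + y + 1) ^ 2 * t"
    using arg_cong[OF Suc_times_shifted_binomial[of k N], of "\<lambda>z. z ^ 2"]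
    by (simp add: t_def t'_def x_def y_def power_mult_distrib add_ac)
  then have t: "t = (y + 1) ^ 2 / (x + y + 1) ^ 2 * t'"
    using x y by (simp add: field_simps)
  \<comment> \<open>The induction step reduces to monotonicity of the geometric factor: the factor \<open>g\<close> at \<open>Suc k\<close>
      satisfies \<open>g = 1 + q * g\<close> for the term ratio \<open>q\<close> there.\<close>
  have ratio_mono: "(x + y) ^ 2 / (x * (x + 2 * y)) \<le> (x + y + 1) ^ 2 / (x * (x + 2 * y + 2))"
  proof -
    have one_plus: "(x + z) ^ 2 / (x * (x + 2 * z)) = 1 + z ^ 2 / (x * (x + 2 * z))" if "z \<ge> 0" for z
    proof -
      have "x * (x + 2 * z) \<noteq> 0" using x that by simp
      moreover have "(x + z) ^ 2 = x * (x + 2 * z) + z ^ 2"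
        by (simp add: algebra_simps power2_eq_square)
      ultimately show ?thesis by (simp add: add_divide_distrib)
    qed
    have "y ^ 2 / (x * (x + 2 * y)) \<le> (y + 1) ^ 2 / (x * (x + 2 * y + 2))"
    proof -
      have "(y + 1) ^ 2 * (x + 2 * y) - y ^ 2 * (x + 2 * y + 2) = 2 * x * y + x + 2 * y ^ 2 + 2 * y"
        by (simp add: algebra_simps power2_eq_square)
      also have "\<dots> \<ge> 0" using x y by simp
      finally have "y ^ 2 * (x + 2 * y + 2) \<le> (y + 1) ^ 2 * (x + 2 * y)" by simp
      then have "x * (y ^ 2 * (x + 2 * y + 2)) \<le> x * ((y + 1) ^ 2 * (x + 2 * y))"
        using x by (intro mult_left_mono) auto
      then show ?thesis
        using x y by (simp add: divide_le_eq le_divide_eq mult_ac)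
    qed
    then show ?thesis
      using one_plus[of y] one_plus[of "y + 1"] y by (simp add: algebra_simps)
  qed
  have "(\<Sum>j\<le>Suc k. real ((N + j) choose j) ^ 2)
      \<le> (x + y) ^ 2 / (x * (x + 2 * y)) * t + t'"
    using Suc.IH by (simp add: x_def y_def t_def t'_def)
  also have "\<dots> \<le> (x + y + 1) ^ 2 / (x * (x + 2 * y + 2)) * t + t'"
    using ratio_mono by (intro add_right_mono mult_right_mono) (simp_all add: t_def)
  also have "\<dots> = (x + y + 1) ^ 2 / (x * (x + 2 * y + 2)) * t'"
  proof -
    have "x * (x + 2 * y + 2) \<noteq> 0" "x + y + 1 \<noteq> 0" using x y by auto
    then show ?thesis
      unfolding t by (simp add: divide_simps) (auto simp: algebra_simps power2_eq_square)
  qed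
  finally show ?case
    by (simp add: x_def y_def t'_def add_ac)
qed

text \<open>
  The new row and the new column without the corner have equal sums by symmetry.
\<close>
lemma K_Suc:
  "real (K (Suc n)) = real (K n) + 2 * (\<Sum>j\<le>n. real ((Suc n + j) choose j) ^ 2)
     + real ((2 * Suc n) choose Suc n) ^ 2"
proof -
  define f where "f i j = real ((i + j) choose i) ^ 2" for i j :: nat
  have f_sym: "f i j = f j i" for i j
    using binomial_symmetric[of i "i + j"] by (simp add: f_def add.commute)
  have col: "(\<Sum>i\<le>n. f i (Suc n)) = (\<Sum>j\<le>n. f (Suc n) j)"
    by (intro sum.cong refl f_sym)
  have "real (K (Suc n)) = (\<Sum>i\<le>n. (\<Sum>j\<le>n. f i j) + f i (Suc n)) + ((\<Sum>j\<le>n. f (Suc n) j) + f (Suc n) (Suc n))"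
    unfolding K_eq_sum_squares f_def[symmetric] by simp
  also have "\<dots> = real (K n) + 2 * (\<Sum>j\<le>n. f (Suc n) j) + f (Suc n) (Suc n)"
    unfolding K_eq_sum_squares f_def[symmetric] by (simp add: sum.distrib col)
  also have "(\<Sum>j\<le>n. f (Suc n) j) = (\<Sum>j\<le>n. real ((Suc n + j) choose j) ^ 2)"
    by (subst f_sym) (simp add: f_def add.commute)
  also have "f (Suc n) (Suc n) = real ((2 * Suc n) choose Suc n) ^ 2"
    by (simp add: f_def mult_2)
  finally show ?thesis .
qed

text \<open>
  The row bound is applied to the new row without its corner, and the corner is added exactly:
  including the corner in the bound would give \<open>4 / 3\<close> of its square for the row, which has the right
  limit but is too large at order \<open>1 / n\<close> for the induction step. From \<open>0\<close> to \<open>1\<close> the left side grows by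
  more than the right side, so the induction starts at \<open>1\<close>.
\<close>
lemma K_le: "real (K n) \<le> 16 / 9 * real ((2 * n) choose n) ^ 2"
proof (cases "n = 0")
  case True
  then show ?thesis by (simp add: K_def)
next
  case False
  then have "n \<ge> 1" by simp
  then show ?thesis
  proof (induction n rule: dec_induct)
    case base
    have "K 1 = 7" by (simp add: K_def)
    then show ?case by (simp add: power2_eq_square)
  next
    case (step n)
    define x where "x = real n"
    have x: "x \<ge> 1" using step by (simp add: x_def)
    define c where "c = real ((Suc n + n) choose n)"
    have c1: "real ((2 * n) choose n) = (x + 1) / (2 * x + 1) * c"
      and c2: "real ((2 * Suc n) choose Suc n) = 2 * c"
      unfolding c_def x_def by (rule central_binomial_via_odd_row)+
    have poly: "16 / 9 * ((x + 1) / (2 * x + 1)) ^ 2 + 2 * ((2 * x + 1) ^ 2 / ((x + 1) * (3 * x + 1)))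
        \<le> 28 / 9"
    proof -
      \<comment> \<open>After clearing denominators, the difference is a polynomial in \<open>x - 1\<close> with nonnegative
          coefficients.\<close>
      define y where "y = x - 1"
      have y: "x = y + 1" "y \<ge> 0" using x by (auto simp: y_def)
      have "28 * (2 * x + 1) ^ 2 * (x + 1) * (3 * x + 1)
            - (16 * (x + 1) ^ 3 * (3 * x + 1) + 18 * (2 * x + 1) ^ 4) \<ge> 0"
        unfolding y(1) using y(2) by (simp add: algebra_simps power_numeral_reduce)
      moreover have "(2 * x + 1) ^ 2 * (x + 1) * (3 * x + 1) > 0" using x by simp
      moreover have "16 / 9 * ((x + 1) / (2 * x + 1)) ^ 2 + 2 * ((2 * x + 1) ^ 2 / ((x + 1) * (3 * x + 1)))
          = (16 * (x + 1) ^ 3 * (3 * x + 1) + 18 * (2 * x + 1) ^ 4)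
            / (9 * ((2 * x + 1) ^ 2 * (x + 1) * (3 * x + 1)))"
        using x by (simp add: divide_simps) (simp add: algebra_simps power_numeral_reduce)
      ultimately show ?thesis
        by (simp add: divide_le_eq mult_ac)
    qed
    have row: "(\<Sum>j\<le>n. real ((Suc n + j) choose j) ^ 2) \<le> (2 * x + 1) ^ 2 / ((x + 1) * (3 * x + 1)) * c ^ 2"
    proof -
      have "real (Suc n + n) = 2 * x + 1" "real (Suc n) = x + 1" "real (Suc n + 2 * n) = 3 * x + 1"
        by (simp_all add: x_def)
      then show ?thesis
        using sum_binomial_squares_le[of "Suc n" n] unfolding c_def by (simp only:)
    qed
    have "real (K (Suc n)) = real (K n) + 2 * (\<Sum>j\<le>n. real ((Suc n + j) choose j) ^ 2) + 4 * c ^ 2"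
      unfolding K_Suc c2 by (simp add: power_mult_distrib)
    also have "\<dots> \<le> 16 / 9 * ((x + 1) / (2 * x + 1) * c) ^ 2
        + 2 * ((2 * x + 1) ^ 2 / ((x + 1) * (3 * x + 1)) * c ^ 2) + 4 * c ^ 2"
      using step.IH row unfolding c1 by linarith
    also have "\<dots> = (16 / 9 * ((x + 1) / (2 * x + 1)) ^ 2
        + 2 * ((2 * x + 1) ^ 2 / ((x + 1) * (3 * x + 1)))) * c ^ 2 + 4 * c ^ 2"
      by (simp only: power_mult_distrib ring_distribs mult.assoc)
    also have "\<dots> \<le> 28 / 9 * c ^ 2 + 4 * c ^ 2"
      by (intro add_right_mono mult_right_mono poly) simp
    also have "\<dots> = 16 / 9 * real ((2 * Suc n) choose Suc n) ^ 2"
      unfolding c2 by (simp add: power_mult_distrib)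
    finally show ?case .
  qed
qed

section \<open>The lower bound and the limit\<close>

text \<open>
  A unit step away from the centre, in either coordinate, multiplies the entry by a quotient
  such as \<open>(n - b) / (2 * n - a - b)\<close>, which tends to \<open>1 / 2\<close>.
\<close>
lemma shifted_central_binomial_ratio_tendsto:
  "(\<lambda>n. real (((n - a) + (n - b)) choose (n - a)) / real ((2 * n) choose n))
     \<longlonglongrightarrow> (1 / 2) ^ (a + b)"
  (is "?r a b \<longlonglongrightarrow> _")
proof -
  have swap: "?r a b = ?r b a" for a b
  proof
    fix n show "?r a b n = ?r b a n"
      using binomial_symmetric[of "n - a" "(n - a) + (n - b)"] by (simp add: add.commute)
  qed
  have step: "?r a (Suc b) \<longlonglongrightarrow> (1 / 2) ^ (a + Suc b)" if "?r a b \<longlonglongrightarrow> (1 / 2) ^ (a + b)" for a b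
  proof -
    have "(\<lambda>n. (real n - real b) / (2 * real n - real a - real b) * ?r a b n)
        \<longlonglongrightarrow> 1 / 2 * (1 / 2) ^ (a + b)"
      by (intro tendsto_mult that) real_asymp
    moreover have "\<forall>\<^sub>F n in sequentially.
        (real n - real b) / (2 * real n - real a - real b) * ?r a b n = ?r a (Suc b) n"
      using eventually_gt_at_top[of "a + b"]
    proof eventually_elim
      case (elim n)
      define m where "m = n - Suc b"
      have m: "n - b = Suc m" "n - Suc b = m" "real n = real m + real b + 1"
        using elim by (auto simp: m_def)
      have sym: "((n - a) + k) choose (n - a) = ((n - a) + k) choose k" for k
        using binomial_symmetric[of k "(n - a) + k"] by simp
      have na: "real (n - a) = real n - real a" using elim by simp
      have "(real n - real b) * real (((n - a) + (n - b)) choose (n - a))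
          = (2 * real n - real a - real b) * real (((n - a) + (n - Suc b)) choose (n - a))"
        using Suc_times_shifted_binomial[of m "n - a"] unfolding m(1,2) sym
        by (simp add: na m(3) algebra_simps)
      moreover have "2 * real n - real a - real b > 0" using elim by simp
      ultimately show ?case
        by (simp add: divide_simps mult_ac)
    qed
    ultimately show ?thesis
      by (auto elim: Lim_transform_eventually)
  qed
  have base: "?r a 0 \<longlonglongrightarrow> (1 / 2) ^ a" for a
  proof (induction a)
    case 0
    have "?r 0 0 = (\<lambda>n. 1)" by (auto simp: mult_2)
    then show ?case by simp
  next
    case (Suc a)
    then show ?case using step[of 0 a] by (simp only: swap[of _ 0]) simp
  qed
  show ?thesis
    by (induction b) (use base step in auto)
qed

lemma K_ratio_ge_partial_sum:
  assumes "n \<ge> M"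
  shows "(\<Sum>a<M. \<Sum>b<M. (real (((n - a) + (n - b)) choose (n - a)) / real ((2 * n) choose n)) ^ 2)
    \<le> real (K n) / real ((2 * n) choose n) ^ 2"
proof -
  define f where "f i j = real ((i + j) choose i) ^ 2" for i j :: nat
  have reindex: "(\<Sum>a<M. g (n - a)) \<le> (\<Sum>i\<le>n. g i)" if "\<And>i. g i \<ge> 0" for g :: "nat \<Rightarrow> real"
  proof -
    have "inj_on (\<lambda>a. n - a) {..<M}" using assms by (auto simp: inj_on_def)
    then have "(\<Sum>a<M. g (n - a)) = sum g ((\<lambda>a. n - a) ` {..<M})"
      by (simp add: sum.reindex)
    also have "\<dots> \<le> (\<Sum>i\<le>n. g i)"
      using that by (intro sum_mono2) auto
    finally show ?thesis .
  qed
  have "(\<Sum>a<M. \<Sum>b<M. f (n - a) (n - b)) \<le> (\<Sum>a<M. \<Sum>j\<le>n. f (n - a) j)"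
    by (intro sum_mono reindex) (simp add: f_def)
  also have "\<dots> \<le> (\<Sum>i\<le>n. \<Sum>j\<le>n. f i j)"
    by (intro reindex sum_nonneg) (simp add: f_def)
  also have "\<dots> = real (K n)"
    by (simp add: K_eq_sum_squares f_def)
  finally have "(\<Sum>a<M. \<Sum>b<M. f (n - a) (n - b)) / real ((2 * n) choose n) ^ 2
      \<le> real (K n) / real ((2 * n) choose n) ^ 2"
    by (rule divide_right_mono) simp
  then show ?thesis
    by (simp add: f_def sum_divide_distrib power_divide)
qed

lemma K_ratio_le: "real (K n) / real ((2 * n) choose n) ^ 2 \<le> 16 / 9"
  using K_le[of n] by (simp add: divide_le_eq)

text \<open>
  Every ratio is at most \<open>16 / 9\<close>; for \<open>l < 16 / 9\<close>, some finite block of the double geometric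
  series already exceeds \<open>l\<close>, and it is the limit of a lower bound of the ratio.
\<close>
lemma K_ratio_tendsto: "(\<lambda>n. real (K n) / real ((2 * n) choose n) ^ 2) \<longlonglongrightarrow> 16 / 9"
proof (rule order_tendstoI)
  fix u :: real assume "16 / 9 < u"
  then show "\<forall>\<^sub>F n in sequentially. real (K n) / real ((2 * n) choose n) ^ 2 < u"
    by (intro always_eventually allI le_less_trans[OF K_ratio_le])
next
  fix l :: real assume l: "l < 16 / 9"
  define G where "G M = (\<Sum>a<M. \<Sum>b<M. ((1 / 2) ^ (a + b)) ^ 2 :: real)" for M :: nat
  have "G = (\<lambda>M. (\<Sum>a<M. (1 / 4) ^ a) * (\<Sum>b<M. (1 / 4) ^ b))"
    by (simp add: G_def fun_eq_iff sum_product power_add power_mult_distrib power_divide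
        flip: power_mult) (simp add: mult.commute[of _ 2] power_mult)
  moreover have "(\<lambda>M. \<Sum>a<M. (1 / 4) ^ a :: real) \<longlonglongrightarrow> 4 / 3"
    using geometric_sums[of "1 / 4 :: real"] by (simp add: sums_def)
  ultimately have "G \<longlonglongrightarrow> 4 / 3 * (4 / 3)"
    by (simp only:) (intro tendsto_mult)
  then obtain M where M: "l < G M"
    using order_tendstoD(1)[of G "16 / 9" sequentially l] l
    by (auto simp: eventually_sequentially)
  have "(\<lambda>n. \<Sum>a<M. \<Sum>b<M. (real (((n - a) + (n - b)) choose (n - a)) / real ((2 * n) choose n)) ^ 2)
      \<longlonglongrightarrow> G M"
    unfolding G_def
    by (intro tendsto_sum tendsto_power shifted_central_binomial_ratio_tendsto)
  from order_tendstoD(1)[OF this M] eventually_ge_at_top[of M]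
  show "\<forall>\<^sub>F n in sequentially. l < real (K n) / real ((2 * n) choose n) ^ 2"
    by eventually_elim (use K_ratio_ge_partial_sum less_le_trans in blast)
qed

section \<open>Asymptotics of the central binomial coefficient\<close>

lemma wallis_prod_eq_central_binomial:
  "(\<Prod>k=1..n. (4 * real k ^ 2) / (4 * real k ^ 2 - 1))
     = 16 ^ n / (real ((2 * n) choose n) ^ 2 * (2 * real n + 1))"
proof (induction n)
  case 0
  then show ?case by simp
next
  case (Suc n)
  define x where "x = real n"
  define c where "c = real ((2 * n) choose n)"
  have x: "x \<ge> 0" and c: "c > 0" by (simp_all add: x_def c_def)
  have c': "real ((2 * Suc n) choose Suc n) = 2 * (2 * x + 1) / (x + 1) * c"
    using central_binomial_via_odd_row[of n] by (simp add: x_def c_def field_simps)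
  have nz: "x + 1 \<noteq> 0" "2 * x + 1 \<noteq> 0" "2 * x + 3 \<noteq> 0" "c \<noteq> 0"
    using x c by auto
  have fac: "4 * (x + 1) ^ 2 - 1 = (2 * x + 1) * (2 * x + 3)"
    by (simp add: algebra_simps power2_eq_square)
  have "(\<Prod>k=1..Suc n. (4 * real k ^ 2) / (4 * real k ^ 2 - 1))
      = 16 ^ n / (c ^ 2 * (2 * x + 1)) * (4 * (x + 1) ^ 2 / (4 * (x + 1) ^ 2 - 1))"
    using Suc.IH by (simp add: x_def c_def add_ac)
  also have "\<dots> = 16 ^ Suc n / ((2 * (2 * x + 1) / (x + 1) * c) ^ 2 * (2 * x + 3))"
    using nz unfolding fac by (simp add: divide_simps) (simp add: algebra_simps power2_eq_square)
  finally show ?case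
    unfolding c' by (simp add: x_def add_ac)
qed

lemma central_binomial_square_asymp:
  "(\<lambda>n. real ((2 * n) choose n) ^ 2 * (pi * real n) / 16 ^ n) \<longlonglongrightarrow> 1"
proof -
  have "(\<lambda>n. 16 ^ n / (real ((2 * n) choose n) ^ 2 * (2 * real n + 1))) \<longlonglongrightarrow> pi / 2"
    using wallis unfolding wallis_prod_eq_central_binomial .
  moreover have "(\<lambda>n. real n / (2 * real n + 1)) \<longlonglongrightarrow> 1 / 2"
    by real_asymp
  ultimately have "(\<lambda>n. pi * (real n / (2 * real n + 1)) / (16 ^ n / (real ((2 * n) choose n) ^ 2 * (2 * real n + 1))))
      \<longlonglongrightarrow> pi * (1 / 2) / (pi / 2)"
    by (intro tendsto_divide[of "\<lambda>n. pi * (real n / (2 * real n + 1))"] tendsto_mult[OF tendsto_const]) simp_all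
  moreover have "pi * (real n / (2 * real n + 1)) / (16 ^ n / (real ((2 * n) choose n) ^ 2 * (2 * real n + 1)))
      = real ((2 * n) choose n) ^ 2 * (pi * real n) / 16 ^ n" for n
  proof -
    have "2 * real n + 1 \<noteq> 0" by (simp add: add_nonneg_eq_0_iff)
    then show ?thesis by simp
  qed
  ultimately show ?thesis by (simp only:) simp
qed

section \<open>The limit, the supremum and the asymptotic formulas\<close>

theorem theorem1p3:
  shows "((\<lambda>n::nat. real (K n) / real ((2 * n) choose n) ^ 2) \<longlonglongrightarrow> 16 / 9)
    \<and> bdd_above (range (\<lambda>n::nat. real (K n) / real ((2 * n) choose n) ^ 2))
    \<and> (SUP n::nat. real (K n) / real ((2 * n) choose n) ^ 2) = 16 / 9
    \<and> (\<exists>e :: nat \<Rightarrow> real. e \<in> o(\<lambda>_. 1) \<and>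
          (\<forall>n. real (K n) = (16 / 9 + e n) * real ((2 * n) choose n) ^ 2))
    \<and> (\<exists>d :: nat \<Rightarrow> real. d \<in> o(\<lambda>_. 1) \<and>
          (\<forall>n\<ge>1. real (K n) = 16 ^ (n + 1) / (9 * pi * real n) * (1 + d n)))"
proof (intro conjI)
  define R where "R n = real (K n) / real ((2 * n) choose n) ^ 2" for n
  have lim: "R \<longlonglongrightarrow> 16 / 9" unfolding R_def by (rule K_ratio_tendsto)
  have le: "R n \<le> 16 / 9" for n unfolding R_def by (rule K_ratio_le)
  have K_eq: "real (K n) = R n * real ((2 * n) choose n) ^ 2" for n
    by (simp add: R_def)
  have smallo: "f \<in> o(\<lambda>_. 1)" if "f \<longlonglongrightarrow> 0" for f :: "nat \<Rightarrow> real"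
    using that by (intro smalloI_tendsto) auto
  show "R \<longlonglongrightarrow> 16 / 9" by (rule lim)
  show bdd: "bdd_above (range R)" using le by (intro bdd_aboveI2)
  show "(SUP n. R n) = 16 / 9"
  proof (rule antisym)
    show "(SUP n. R n) \<le> 16 / 9" by (intro cSUP_least le) simp
    show "16 / 9 \<le> (SUP n. R n)"
      by (rule LIMSEQ_le_const2[OF lim]) (intro exI allI impI cSUP_upper UNIV_I bdd)
  qed
  show "\<exists>e. e \<in> o(\<lambda>_. 1) \<and> (\<forall>n. real (K n) = (16 / 9 + e n) * real ((2 * n) choose n) ^ 2)"
  proof (intro exI conjI allI)
    have "(\<lambda>n. R n - 16 / 9) \<longlonglongrightarrow> 0" using lim by (simp add: LIM_zero)
    then show "(\<lambda>n. R n - 16 / 9) \<in> o(\<lambda>_. 1)" by (rule smallo)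
  qed (simp add: K_eq)
  define d where "d n = 9 / 16 * R n * (real ((2 * n) choose n) ^ 2 * (pi * real n) / 16 ^ n) - 1" for n
  show "\<exists>d. d \<in> o(\<lambda>_. 1) \<and> (\<forall>n\<ge>1. real (K n) = 16 ^ (n + 1) / (9 * pi * real n) * (1 + d n))"
  proof (intro exI conjI allI impI)
    have "d \<longlonglongrightarrow> 9 / 16 * (16 / 9) * 1 - 1"
      unfolding d_def by (intro tendsto_intros lim central_binomial_square_asymp)
    then show "d \<in> o(\<lambda>_. 1)" by (intro smallo) simp
    show "real (K n) = 16 ^ (n + 1) / (9 * pi * real n) * (1 + d n)" if "n \<ge> 1" for n
      using that by (simp add: K_eq d_def)
  qed
qed

end
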